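(* Let $\Omega\subset B=\{|\mathbf{x}|<1\}\subset\mathbb{R}^2$ be a compact domain with smooth boundary, let $u_m>0$ be a maximum possible density value, and let $f=n_e\chi_\Omega$ where $n_e\in[0,u_m]$ is constant. Let $\varphi=\frac{1}{\epsilon^2}\chi_{B_\epsilon(0)}$ for some $\epsilon>0$. Then, if $\epsilon$ is small enough, $\mathcal{R}f$ uniquely determines $n_e$; that is, there is $\epsilon_0>0$ such that for every $0<\epsilon<\epsilon_0$ and all $n_e,n_e'\in[0,u_m]$, $\mathcal{R}(n_e\chi_\Omega)=\mathcal{R}(n_e'\chi_\Omega)$ implies $n_e=n_e'$.
   Context: Fix $a,b>0$ and $2\psi\in(0,\pi)$. The V-line transform is $$\mathcal{V}_{a,b}f(\mathbf{x},\phi)=a\int_0^\infty f(\mathbf{x}+t\Phi)\,dt+b\int_0^\infty f(\mathbf{x}+t\Phi')\,dt,$$ with $\Phi=(\cos(\phi+2\psi-\pi/2),\sin(\phi+2\psi-\pi/2))$, $\Phi'=(\cos(\phi-\pi/2),\sin(\phi-\pi/2))$. Its smoothed version with kernel $\varphi$ is $\widetilde{\mathcal{V}_{a,b}}f(\cdot,\phi)=\varphi*\mathcal{V}_{a,b}f(\cdot,\phi)$ (convolution in $\mathbf{x}$). $B_\epsilon(0)$ is the disc of radius $\epsilon$ centred at the origin. For $s\in\mathbb{R}$, $\theta\in[-\pi,\pi]$ let $\Theta=(\cos\theta,\sin\theta)$ and $L(s,\theta)=\{\mathbf{x}\in\mathbb{R}^2:\mathbf{x}\cdot\Theta=s\}$.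 The non-linear transform (which depends on $\epsilon$ through $\varphi$) is $$\mathcal{R}f(s,\theta)=c_0\int_{L(s,\theta)}w(\mathbf{x})f(\mathbf{x})e^{-\widetilde{\mathcal{V}_{a,b}}f(\mathbf{x},\theta)}\,dl(\mathbf{x}),\qquad s\in\mathbb{R},\ \theta\in[-\pi,\pi],$$ where $c_0>0$ is a constant, $w$ is a fixed smooth weight with $w>0$ on $B$, and $dl$ is arc length. *)

theory Defs
  imports "HOL-Analysis.Analysis"
begin

section \<open>Smooth functions and compact domains with smooth boundary\<close>

text \<open>\<open>Ck_on k S f\<close>, for open \<open>S\<close>: all iterated directional derivatives of \<open>f\<close> up to order \<open>k\<close>
  exist and are continuous on \<open>S\<close>.\<close>

primrec Ck_on :: "nat \<Rightarrow> 'a::real_normed_vector set \<Rightarrow> ('a \<Rightarrow> 'b::real_normed_vector) \<Rightarrow> bool" where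
  "Ck_on 0 S f \<longleftrightarrow> continuous_on S f"
| "Ck_on (Suc k) S f \<longleftrightarrow>
     (\<forall>x\<in>S. f differentiable (at x)) \<and>
     (\<forall>v. Ck_on k S (\<lambda>x. frechet_derivative f (at x) v))"

definition smooth_on :: "'a::real_normed_vector set \<Rightarrow> ('a \<Rightarrow> 'b::real_normed_vector) \<Rightarrow> bool" where
  "smooth_on S f \<longleftrightarrow> (\<forall>k. Ck_on k S f)"

definition compact_domain :: "'a::real_normed_vector set \<Rightarrow> bool" where
  "compact_domain \<Omega> \<longleftrightarrow>
     compact \<Omega> \<and> interior \<Omega> \<noteq> {} \<and> connected (interior \<Omega>) \<and> \<Omega> = closure (interior \<Omega>)"

text \<open>Near each boundary point the set is a sublevel set of a smooth local defining function
  whose differential does not vanish at that point.\<close>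

definition smooth_boundary :: "'a::real_normed_vector set \<Rightarrow> bool" where
  "smooth_boundary \<Omega> \<longleftrightarrow>
     (\<forall>p\<in>frontier \<Omega>. \<exists>U (g :: 'a \<Rightarrow> real).
        open U \<and> p \<in> U \<and> smooth_on U g \<and>
        frechet_derivative g (at p) \<noteq> (\<lambda>v. 0) \<and>
        \<Omega> \<inter> U = {x\<in>U. g x \<le> 0})"


section \<open>The V-line transform and its smoothed version\<close>

definition dir :: "real \<Rightarrow> real ^ 2" where
  "dir \<alpha> = vector [cos \<alpha>, sin \<alpha>]"

definition V_line :: "real \<Rightarrow> real \<Rightarrow> real \<Rightarrow> (real ^ 2 \<Rightarrow> real) \<Rightarrow> real ^ 2 \<Rightarrow> real \<Rightarrow> real" where
  "V_line a b \<psi> f x \<phi> =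
     a * (LINT t:{0..}|lborel. f (x + t *\<^sub>R dir (\<phi> + 2 * \<psi> - pi / 2))) +
     b * (LINT t:{0..}|lborel. f (x + t *\<^sub>R dir (\<phi> - pi / 2)))"

definition convol :: "(real ^ 2 \<Rightarrow> real) \<Rightarrow> (real ^ 2 \<Rightarrow> real) \<Rightarrow> real ^ 2 \<Rightarrow> real" where
  "convol k g x = (LINT y|lborel. k (x - y) * g y)"

definition smoothed_V_line ::
  "(real ^ 2 \<Rightarrow> real) \<Rightarrow> real \<Rightarrow> real \<Rightarrow> real \<Rightarrow> (real ^ 2 \<Rightarrow> real) \<Rightarrow> real ^ 2 \<Rightarrow> real \<Rightarrow> real" where
  "smoothed_V_line k a b \<psi> f x \<phi> = convol k (\<lambda>y. V_line a b \<psi> f y \<phi>) x"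

definition disc_kernel :: "real \<Rightarrow> real ^ 2 \<Rightarrow> real" where
  "disc_kernel \<epsilon> x = 1 / \<epsilon>\<^sup>2 * indicator (ball 0 \<epsilon>) x"


section \<open>The non-linear transform\<close>

definition line :: "real \<Rightarrow> real \<Rightarrow> (real ^ 2) set" where
  "line s \<theta> = {x. x \<bullet> dir \<theta> = s}"

text \<open>The integral over \<open>line s \<theta>\<close> with respect to arc length is written with the parametrisation
  \<open>line_param s \<theta>\<close>; the two lemmas after it show that this is an isometry of the real line onto
  \<open>line s \<theta>\<close>.\<close>

definition line_param :: "real \<Rightarrow> real \<Rightarrow> real \<Rightarrow> real ^ 2" where
  "line_param s \<theta> t = s *\<^sub>R dir \<theta> + t *\<^sub>R dir (\<theta> + pi / 2)"

lemma range_line_param: "range (line_param s \<theta>) = line s \<theta>"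
proof (intro equalityI subsetI)
  fix x assume "x \<in> range (line_param s \<theta>)"
  then obtain t where x: "x = line_param s \<theta> t"
    by blast
  have "x \<bullet> dir \<theta> =
      (s * cos \<theta> - t * sin \<theta>) * cos \<theta> + (s * sin \<theta> + t * cos \<theta>) * sin \<theta>"
    by (simp add: x line_param_def dir_def inner_vec_def sum_2 cos_add sin_add)
  also have "\<dots> = s * ((sin \<theta>)\<^sup>2 + (cos \<theta>)\<^sup>2)"
    by algebra
  finally have "x \<bullet> dir \<theta> = s"
    by simp
  then show "x \<in> line s \<theta>"
    by (simp add: line_def)
next
  fix x assume "x \<in> line s \<theta>"
  then have s: "s = x $ 1 * cos \<theta> + x $ 2 * sin \<theta>"
    by (simp add: line_def dir_def inner_vec_def sum_2)
  define t where "t = x $ 2 * cos \<theta> - x $ 1 * sin \<theta>"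
  have 1: "s * cos \<theta> - t * sin \<theta> = x $ 1 * ((sin \<theta>)\<^sup>2 + (cos \<theta>)\<^sup>2)"
    unfolding s t_def by algebra
  have 2: "s * sin \<theta> + t * cos \<theta> = x $ 2 * ((sin \<theta>)\<^sup>2 + (cos \<theta>)\<^sup>2)"
    unfolding s t_def by algebra
  have "x = line_param s \<theta> t"
    using 1 2 by (simp add: line_param_def dir_def vec_eq_iff forall_2 cos_add sin_add)
  then show "x \<in> range (line_param s \<theta>)"
    by blast
qed

lemma dist_line_param: "dist (line_param s \<theta> t) (line_param s \<theta> u) = \<bar>t - u\<bar>"
proof -
  have "norm (dir (\<theta> + pi / 2)) = 1"
    by (simp add: dir_def norm_vec_def L2_set_def sum_2)
  moreover have "line_param s \<theta> t - line_param s \<theta> u = (t - u) *\<^sub>R dir (\<theta> + pi / 2)"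
    by (simp add: line_param_def algebra_simps)
  ultimately show ?thesis
    by (simp add: dist_norm)
qed

definition line_integral :: "real \<Rightarrow> real \<Rightarrow> (real ^ 2 \<Rightarrow> real) \<Rightarrow> real" where
  "line_integral s \<theta> h = (LINT t|lborel. h (line_param s \<theta> t))"

definition R_transform ::
  "real \<Rightarrow> real \<Rightarrow> real \<Rightarrow> (real ^ 2 \<Rightarrow> real) \<Rightarrow> real \<Rightarrow> (real ^ 2 \<Rightarrow> real) \<Rightarrow>
   (real ^ 2 \<Rightarrow> real) \<Rightarrow> real \<Rightarrow> real \<Rightarrow> real" where
  "R_transform a b \<psi> k c0 w f s \<theta> =
     c0 * line_integral s \<theta> (\<lambda>x. w x * f x * exp (- smoothed_V_line k a b \<psi> f x \<theta>))"

end

theory Submission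
  imports Defs
begin

text \<open>Let \<open>p\<close> be a point of \<open>\<Omega>\<close> farthest from the origin, \<open>R = \<bar>p\<bar>\<close> and \<open>p = R \<Theta>\<close>. For \<open>r\<close> close to
  \<open>R\<close> the cap \<open>{x \<in> \<Omega>. r \<le> x \<bullet> \<Theta>}\<close> has small diameter. Neither ray of the V-line in direction \<open>\<theta>\<close>
  decreases \<open>x \<bullet> \<Theta>\<close>, so a ray that starts in this half plane meets \<open>\<Omega>\<close> only inside the cap. Hence
  the smoothed V-line transform \<open>T\<close> of the indicator function of \<open>\<Omega>\<close> satisfies \<open>u\<^sub>m T < 1\<close> on a
  line \<open>x \<bullet> \<Theta> = s\<close> with \<open>r + \<epsilon> < s < R\<close>. There \<open>n \<mapsto> n exp (- n T)\<close> is strictly increasing on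
  \<open>[0, u\<^sub>m]\<close>, and since \<open>\<Omega>\<close> is the closure of its interior, the line can be chosen to meet the
  interior of \<open>\<Omega>\<close>, which makes the integral over it strictly increasing in \<open>n\<close>.\<close>

section \<open>Unit directions in the plane\<close>

lemma inner_dir_dir: "dir \<alpha> \<bullet> dir \<beta> = cos (\<alpha> - \<beta>)"
  by (simp add: dir_def inner_vec_def sum_2 cos_diff)

lemma norm_dir [simp]: "norm (dir \<alpha>) = 1"
  by (simp add: norm_eq_sqrt_inner inner_dir_dir)

text \<open>This is the polar form of the complex number with the coordinates of \<open>p\<close>.
  The angle is kept in \<open>{-pi..pi}\<close> because only those angles are available for
  comparing the transforms.\<close>

lemma polar_dir_exists:
  fixes p :: "real ^ 2"
  shows "\<exists>\<theta>\<in>{-pi..pi}. p = norm p *\<^sub>R dir \<theta>"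
proof -
  define z where "z = Complex (p $ 1) (p $ 2)"
  have "norm z = norm p"
    by (simp add: z_def cmod_def norm_vec_def L2_set_def sum_2)
  moreover have "z = complex_of_real (norm z) * cis (Arg z)"
    by (metis rcis_cmod_Arg rcis_def)
  ultimately have "z = complex_of_real (norm p) * cis (Arg z)"
    by simp
  then have "p = norm p *\<^sub>R dir (Arg z)"
    by (simp add: z_def complex_eq_iff dir_def vec_eq_iff forall_2)
  then show ?thesis
    using Arg_bounded[of z] by (intro bexI[of _ "Arg z"]) auto
qed

section \<open>Strict monotonicity\<close>

lemma lborel_integral_strict_mono:
  fixes f g :: "'a::euclidean_space \<Rightarrow> real"
  assumes int: "integrable lborel f" "integrable lborel g"
    and le: "\<And>x. f x \<le> g x"
    and S: "open S" "S \<noteq> {}" "\<And>x. x \<in> S \<Longrightarrow> f x < g x"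
  shows "integral\<^sup>L lborel f < integral\<^sup>L lborel g"
proof (rule ccontr)
  have d: "integrable lborel (\<lambda>x. g x - f x)"
    using int by simp
  assume "\<not> integral\<^sup>L lborel f < integral\<^sup>L lborel g"
  moreover have "integral\<^sup>L lborel f \<le> integral\<^sup>L lborel g"
    using int le by (intro integral_mono) auto
  \<comment> \<open>A nonnegative function with integral 0 vanishes almost everywhere. This makes
    \<open>S\<close> a null set, which a nonempty open set cannot be.\<close>
  ultimately have "integral\<^sup>L lborel (\<lambda>x. g x - f x) = 0"
    using int by simp
  then have "AE x in lborel. g x - f x = 0"
    using le integral_nonneg_eq_0_iff_AE[OF d] by simp
  then have "AE x in lborel. x \<notin> S"
    by eventually_elim (use S(3) in force)
  then have "S \<in> null_sets lborel"
    using S(1) by (simp add: AE_iff_null_sets)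
  then have "negligible S"
    by (simp add: negligible_iff_null_sets null_sets_completionI)
  then show False
    using open_not_negligible S by blast
qed

text \<open>After division by \<open>exp (- (m * T))\<close>, the tangent bound
  \<open>1 + x \<le> exp x\<close> at \<open>x = - ((n - m) * T)\<close> reduces the claim to
  \<open>(n - m) * (n * T) < n - m\<close>.\<close>

lemma mult_exp_neg_strict_mono:
  fixes m n T :: real
  assumes "0 \<le> m" "m < n" "n * T < 1"
  shows "m * exp (- (m * T)) < n * exp (- (n * T))"
proof -
  have "m < n * (1 - (n - m) * T)"
  proof -
    have "(n - m) * (n * T) < (n - m) * 1"
      using assms by (intro mult_strict_left_mono) auto
    then show ?thesis
      by (simp add: algebra_simps)
  qed
  also have "\<dots> \<le> n * exp (- ((n - m) * T))"
    using assms exp_ge_add_one_self[of "- ((n - m) * T)"] by (intro mult_left_mono) auto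
  finally have "m * exp (- (m * T)) < n * exp (- ((n - m) * T)) * exp (- (m * T))"
    by simp
  also have "\<dots> = n * exp (- (n * T))"
    by (simp add: mult.assoc algebra_simps flip: exp_add)
  finally show ?thesis .
qed

section \<open>Caps and rays of small diameter\<close>

text \<open>By the parallelogram law, the squared distance is at most \<open>4 * R\<^sup>2\<close>
  minus the squared norm of \<open>u + v\<close>, and that norm is at least
  \<open>(u + v) \<bullet> e\<close>, hence at least \<open>2 * r\<close>.\<close>

lemma cap_dist_le:
  fixes u v e :: "'a::real_inner"
  assumes "norm e = 1" "0 \<le> r" "norm u \<le> R" "norm v \<le> R" "r \<le> u \<bullet> e" "r \<le> v \<bullet> e"
    and "4 * R\<^sup>2 - 4 * r\<^sup>2 \<le> D\<^sup>2" "0 \<le> D"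
  shows "dist u v \<le> D"
proof -
  have "2 * r \<le> (u + v) \<bullet> e"
    using assms by (simp add: inner_add_left)
  also have "\<dots> \<le> norm (u + v)"
    using norm_cauchy_schwarz[of "u + v" e] assms(1) by simp
  finally have "(2 * r)\<^sup>2 \<le> (norm (u + v))\<^sup>2"
    using assms(2) by (intro power_mono) auto
  moreover have "(norm (u - v))\<^sup>2 + (norm (u + v))\<^sup>2 = 2 * (norm u)\<^sup>2 + 2 * (norm v)\<^sup>2"
    by (simp add: power2_norm_eq_inner algebra_simps inner_commute)
  moreover have "(norm u)\<^sup>2 \<le> R\<^sup>2" "(norm v)\<^sup>2 \<le> R\<^sup>2"
    using assms by (auto intro: power_mono)
  ultimately have "(norm (u - v))\<^sup>2 \<le> D\<^sup>2"
    using assms(7) by (simp add: power2_eq_square)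
  then show ?thesis
    unfolding dist_norm using assms(8) by (rule power2_le_imp_le)
qed

text \<open>The integral is the length of the set of parameters at which the ray is in
  \<open>\<Omega>\<close>. As the ray has unit speed, this set lies within \<open>D\<close> of any
  one of its points.\<close>

lemma ray_integral_le:
  fixes y d :: "'a::euclidean_space"
  assumes "closed \<Omega>" "norm d = 1" "0 \<le> D"
    and diam: "\<And>t u. 0 \<le> t \<Longrightarrow> 0 \<le> u \<Longrightarrow> y + t *\<^sub>R d \<in> \<Omega> \<Longrightarrow> y + u *\<^sub>R d \<in> \<Omega> \<Longrightarrow>
      dist (y + t *\<^sub>R d) (y + u *\<^sub>R d) \<le> D"
  shows "(LINT t:{0..}|lborel. indicator \<Omega> (y + t *\<^sub>R d) :: real) \<le> 2 * D"
proof -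
  define S where "S = {t. 0 \<le> t \<and> y + t *\<^sub>R d \<in> \<Omega>}"
  have "(LINT t:{0..}|lborel. indicator \<Omega> (y + t *\<^sub>R d) :: real) = (LINT t|lborel. indicator S t)"
    unfolding set_lebesgue_integral_def
    by (intro Bochner_Integration.integral_cong) (auto simp: S_def indicator_def)
  also have "\<dots> = measure lborel S"
    by simp
  also have "\<dots> \<le> 2 * D"
  proof (cases "S = {}")
    case False
    then obtain t0 where t0: "t0 \<in> S"
      by blast
    have "\<bar>t - t0\<bar> \<le> D" if "t \<in> S" for t
    proof -
      have "y + t *\<^sub>R d - (y + t0 *\<^sub>R d) = (t - t0) *\<^sub>R d"
        by (simp add: algebra_simps)
      then show ?thesis
        using diam[of t t0] that t0 assms(2) by (simp add: S_def dist_norm)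
    qed
    then have "S \<subseteq> {t0 - D..t0 + D}"
      by (force simp: abs_le_iff)
    then have "measure lborel S \<le> measure lborel {t0 - D..t0 + D}"
    proof (intro measure_mono_fmeasurable)
      have "closed ({0..} \<inter> (\<lambda>t. y + t *\<^sub>R d) -` \<Omega>)"
        using assms(1) by (intro closed_Int closed_vimage continuous_intros) auto
      moreover have "{0..} \<inter> (\<lambda>t. y + t *\<^sub>R d) -` \<Omega> = S"
        by (auto simp: S_def)
      ultimately show "S \<in> sets lborel"
        by (simp add: borel_closed)
    qed (auto simp: fmeasurable_def emeasure_lborel_Icc_eq)
    then show ?thesis
      using assms(3) by simp
  qed (use assms(3) in auto)
  finally show ?thesis .
qed

section \<open>The smoothed V-line transform\<close>

lemma smoothed_V_line_mult:
  "smoothed_V_line k a b \<psi> (\<lambda>x. c * f x) x \<phi> = c * smoothed_V_line k a b \<psi> f x \<phi>"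
proof -
  have V: "V_line a b \<psi> (\<lambda>x. c * f x) y \<phi> = c * V_line a b \<psi> f y \<phi>" for y
    by (simp add: V_line_def algebra_simps)
  have "smoothed_V_line k a b \<psi> (\<lambda>x. c * f x) x \<phi> =
      (LINT y|lborel. c * (k (x - y) * V_line a b \<psi> f y \<phi>))"
    by (simp add: smoothed_V_line_def convol_def V mult.left_commute)
  then show ?thesis
    by (simp add: smoothed_V_line_def convol_def)
qed

lemma borel_measurable_V_line:
  assumes [measurable]: "f \<in> borel_measurable borel"
  shows "(\<lambda>x. V_line a b \<psi> f x \<phi>) \<in> borel_measurable borel"
  unfolding V_line_def set_lebesgue_integral_def by measurable

lemma borel_measurable_smoothed_V_line:
  assumes [measurable]: "k \<in> borel_measurable borel" "f \<in> borel_measurable borel"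
  shows "(\<lambda>x. smoothed_V_line k a b \<psi> f x \<phi>) \<in> borel_measurable borel"
proof -
  note [measurable] = borel_measurable_V_line
  show ?thesis
    unfolding smoothed_V_line_def convol_def by measurable
qed

lemma borel_measurable_disc_kernel [measurable]: "disc_kernel \<epsilon> \<in> borel_measurable borel"
  unfolding disc_kernel_def by (intro borel_measurable_times borel_measurable_const borel_measurable_indicator) simp

text \<open>The factor \<open>pi\<close> is the total mass of \<open>disc_kernel \<epsilon>\<close>,
  whatever \<open>\<epsilon>\<close> is.\<close>

lemma convol_disc_kernel_le:
  assumes "0 < \<epsilon>" "0 \<le> M"
    and bnd: "\<And>y. y \<in> ball x \<epsilon> \<Longrightarrow> g y \<le> M"
  shows "convol (disc_kernel \<epsilon>) g x \<le> pi * M"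
proof -
  have *: "disc_kernel \<epsilon> (x - y) = 1 / \<epsilon>\<^sup>2 * indicator (ball x \<epsilon>) y" for y
    by (simp add: disc_kernel_def indicator_def dist_norm norm_minus_commute)
  have "convol (disc_kernel \<epsilon>) g x \<le> (LINT y|lborel. M / \<epsilon>\<^sup>2 * indicator (ball x \<epsilon>) y)"
    unfolding convol_def
  \<comment> \<open>A non-integrable integrand has integral 0 by convention, and the nonnegative
    majorant covers that case too.\<close>
  proof (rule integral_mono')
    show "integrable lborel (\<lambda>y. M / \<epsilon>\<^sup>2 * indicator (ball x \<epsilon>) y :: real)"
      using emeasure_bounded_finite[OF bounded_ball[of x \<epsilon>]]
      by (intro integrable_mult_right integrable_real_indicator) auto
  qed (use assms in \<open>auto simp: * indicator_def divide_right_mono\<close>)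
  also have "\<dots> = M / \<epsilon>\<^sup>2 * measure lborel (ball x \<epsilon>)"
    by simp
  also have "measure lborel (ball x \<epsilon>) = pi * \<epsilon>\<^sup>2"
    using assms(1) content_ball[of \<epsilon> x] unit_ball_vol_2 by simp
  finally show ?thesis
    using assms(1) by (simp add: field_simps)
qed

text \<open>The margin \<open>\<epsilon>\<close> keeps the whole averaging disc around
  \<open>x\<close> in the half plane beyond \<open>r\<close>, so every ray involved meets
  \<open>\<Omega>\<close> only in the cap.\<close>

lemma smoothed_V_line_indicator_le:
  assumes "closed \<Omega>" "0 \<le> a" "0 \<le> b" "0 \<le> 2 * \<psi>" "2 * \<psi> \<le> pi" "0 < \<epsilon>" "0 \<le> D"
    and diam: "\<And>u v. u \<in> \<Omega> \<Longrightarrow> v \<in> \<Omega> \<Longrightarrow> r \<le> u \<bullet> dir \<theta> \<Longrightarrow> r \<le> v \<bullet> dir \<theta> \<Longrightarrow> dist u v \<le> D"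
    and x: "r + \<epsilon> \<le> x \<bullet> dir \<theta>"
  shows "smoothed_V_line (disc_kernel \<epsilon>) a b \<psi> (indicator \<Omega>) x \<theta> \<le> pi * ((a + b) * (2 * D))"
  unfolding smoothed_V_line_def
proof (rule convol_disc_kernel_le)
  fix y assume y: "y \<in> ball x \<epsilon>"
  have "x \<bullet> dir \<theta> - y \<bullet> dir \<theta> \<le> norm (x - y)"
    using norm_cauchy_schwarz[of "x - y" "dir \<theta>"] by (simp add: inner_diff_left)
  with x y have ry: "r \<le> y \<bullet> dir \<theta>"
    by (simp add: dist_norm)
  have ray: "(LINT t:{0..}|lborel. indicator \<Omega> (y + t *\<^sub>R dir \<alpha>) :: real) \<le> 2 * D"
    if "0 \<le> dir \<alpha> \<bullet> dir \<theta>" for \<alpha>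
  proof (rule ray_integral_le)
    fix t u :: real
    assume *: "0 \<le> t" "0 \<le> u" "y + t *\<^sub>R dir \<alpha> \<in> \<Omega>" "y + u *\<^sub>R dir \<alpha> \<in> \<Omega>"
    have "r \<le> (y + t *\<^sub>R dir \<alpha>) \<bullet> dir \<theta>" if "0 \<le> t" for t
      using mult_nonneg_nonneg[OF that \<open>0 \<le> dir \<alpha> \<bullet> dir \<theta>\<close>] ry by (simp add: inner_add_left)
    with * show "dist (y + t *\<^sub>R dir \<alpha>) (y + u *\<^sub>R dir \<alpha>) \<le> D"
      by (intro diam) auto
  qed (use assms in auto)
  \<comment> \<open>The two inner products are \<open>sin (2 * \<psi>)\<close> and 0.\<close>
  have "0 \<le> dir (\<theta> + 2 * \<psi> - pi / 2) \<bullet> dir \<theta>" "0 \<le> dir (\<theta> - pi / 2) \<bullet> dir \<theta>"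
    using assms sin_ge_zero[of "2 * \<psi>"] by (simp_all add: inner_dir_dir cos_diff)
  then show "V_line a b \<psi> (indicator \<Omega>) y \<theta> \<le> (a + b) * (2 * D)"
    unfolding V_line_def distrib_right using assms(2,3) by (intro add_mono mult_left_mono ray) auto
qed (use assms in auto)

lemma smoothed_V_line_nonneg:
  assumes "0 \<le> a" "0 \<le> b" "\<And>x. 0 \<le> k x" "\<And>x. 0 \<le> f x"
  shows "0 \<le> smoothed_V_line k a b \<psi> f x \<phi>"
proof -
  have "0 \<le> V_line a b \<psi> f y \<phi>" for y
    unfolding V_line_def set_lebesgue_integral_def
    using assms by (intro add_nonneg_nonneg mult_nonneg_nonneg Bochner_Integration.integral_nonneg) auto
  then show ?thesis
    unfolding smoothed_V_line_def convol_def
    using assms by (intro Bochner_Integration.integral_nonneg mult_nonneg_nonneg) auto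
qed

section \<open>Integrals over lines\<close>

lemma continuous_on_line_param: "continuous_on A (line_param s \<theta>)"
  unfolding line_param_def by (intro continuous_intros)

lemma compact_line_param_vimage:
  assumes "compact \<Omega>"
  shows "compact (line_param s \<theta> -` \<Omega>)"
proof -
  have "closed (line_param s \<theta> -` \<Omega>)"
    using assms by (intro closed_vimage continuous_on_line_param compact_imp_closed)
  moreover have "bounded (line_param s \<theta> -` \<Omega>)"
  proof -
    obtain B where B: "\<And>u v. u \<in> \<Omega> \<Longrightarrow> v \<in> \<Omega> \<Longrightarrow> dist u v \<le> B"
      using assms compact_imp_bounded bounded_two_points by metis
    have "dist t u \<le> B" if "line_param s \<theta> t \<in> \<Omega>" "line_param s \<theta> u \<in> \<Omega>" for t u
      using B[OF that] by (simp add: dist_line_param dist_real_def)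
    then show ?thesis
      by (auto simp: bounded_two_points)
  qed
  ultimately show ?thesis
    by (simp add: compact_eq_bounded_closed)
qed

text \<open>By homogeneity the integrand on \<open>\<Omega>\<close> is \<open>w\<close> times
  \<open>n * exp (- (n * T))\<close>, with \<open>T\<close> independent of \<open>n\<close>, and it
  is 0 elsewhere. The point \<open>q\<close> ensures that the increase is strict on a nonempty open
  set of parameters.\<close>

lemma R_transform_strict_mono:
  assumes "compact \<Omega>" "0 \<le> a" "0 \<le> b" "0 < c0"
    and w: "continuous_on UNIV w" "\<And>x. x \<in> \<Omega> \<Longrightarrow> w x > 0"
    and k [measurable]: "k \<in> borel_measurable borel" and k0: "\<And>x. 0 \<le> k x"
    and q: "q \<in> interior \<Omega>" "q \<in> line s \<theta>"
    and small: "\<And>x. x \<in> line s \<theta> \<Longrightarrow> n * smoothed_V_line k a b \<psi> (indicator \<Omega>) x \<theta> < 1"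
    and mn: "0 \<le> m" "m < n"
  shows "R_transform a b \<psi> k c0 w (\<lambda>x. m * indicator \<Omega> x) s \<theta> <
    R_transform a b \<psi> k c0 w (\<lambda>x. n * indicator \<Omega> x) s \<theta>"
proof -
  define T where "T = (\<lambda>x. smoothed_V_line k a b \<psi> (indicator \<Omega>) x \<theta>)"
  define \<gamma> where "\<gamma> = line_param s \<theta>"
  define F where "F = (\<lambda>c t. w (\<gamma> t) * (c * indicator \<Omega> (\<gamma> t)) * exp (- (c * T (\<gamma> t))))"
  have \<gamma>_line: "\<gamma> t \<in> line s \<theta>" for t
    using range_line_param[of s \<theta>] by (auto simp: \<gamma>_def)
  have cont: "continuous_on A \<gamma>" for A
    unfolding \<gamma>_def by (rule continuous_on_line_param)
  have [measurable]: "\<gamma> \<in> borel_measurable borel"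
    by (intro borel_measurable_continuous_onI cont)
  have [measurable]: "w \<in> borel_measurable borel"
    by (intro borel_measurable_continuous_onI w)
  have [measurable]: "\<Omega> \<in> sets borel"
    using assms(1) by (simp add: borel_compact)
  have [measurable]: "T \<in> borel_measurable borel"
    unfolding T_def by (intro borel_measurable_smoothed_V_line) auto
  have T0: "0 \<le> T x" for x
    unfolding T_def using assms by (intro smoothed_V_line_nonneg) auto
  have R: "R_transform a b \<psi> k c0 w (\<lambda>x. c * indicator \<Omega> x) s \<theta> = c0 * (LINT t|lborel. F c t)" for c
    by (simp add: R_transform_def line_integral_def smoothed_V_line_mult T_def F_def \<gamma>_def)
  have int: "integrable lborel (F c)" if "0 \<le> c" for c
  proof -
    have "compact (w ` \<Omega>)"
      using w(1) assms(1) by (intro compact_continuous_image continuous_on_subset[OF w(1)]) auto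
    then obtain W where W: "\<And>x. x \<in> \<Omega> \<Longrightarrow> norm (w x) \<le> W"
      by (meson bounded_iff compact_imp_bounded image_eqI)
    show ?thesis
    proof (rule Bochner_Integration.integrable_bound)
      \<comment> \<open>Since \<open>T\<close> is nonnegative, the exponential is at most 1.\<close>
      show "integrable lborel (\<lambda>t. W * c * indicator (\<gamma> -` \<Omega>) t)"
        using compact_line_param_vimage[OF assms(1), of s \<theta>]
          emeasure_compact_finite[OF compact_line_param_vimage[OF assms(1), of s \<theta>]]
        by (intro integrable_mult_right integrable_real_indicator)
          (simp_all add: \<gamma>_def borel_compact)
      show "F c \<in> borel_measurable lborel"
        unfolding F_def by measurable
      show "AE t in lborel. norm (F c t) \<le> norm (W * c * indicator (\<gamma> -` \<Omega>) t)"
      proof (intro AE_I2)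
        fix t
        show "norm (F c t) \<le> norm (W * c * indicator (\<gamma> -` \<Omega>) t)"
        proof (cases "\<gamma> t \<in> \<Omega>")
          case True
          then have "\<bar>w (\<gamma> t)\<bar> * c * exp (- (c * T (\<gamma> t))) \<le> W * c * 1"
            using W[OF True] that T0[of "\<gamma> t"] order_trans[OF norm_ge_zero W[OF True]]
            by (intro mult_mono) auto
          moreover have "0 \<le> W"
            using order_trans[OF norm_ge_zero W[OF True]] .
          ultimately show ?thesis
            using True that by (simp add: F_def abs_mult)
        qed (simp add: F_def)
      qed
    qed
  qed
  have less: "F m t < F n t" if "\<gamma> t \<in> \<Omega>" for t
    using mult_exp_neg_strict_mono[OF mn small[OF \<gamma>_line, folded T_def]] w(2)[OF that] that
    by (simp add: F_def T_def mult.assoc)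
  have le: "F m t \<le> F n t" for t
    using less[of t] by (cases "\<gamma> t \<in> \<Omega>") (auto simp: F_def)
  have "open (\<gamma> -` interior \<Omega>)"
    by (intro open_vimage cont) auto
  moreover have "\<gamma> -` interior \<Omega> \<noteq> {}"
  proof -
    obtain t where "q = \<gamma> t"
      using q(2) range_line_param[of s \<theta>] unfolding \<gamma>_def by blast
    with q(1) show ?thesis
      by auto
  qed
  ultimately have "(LINT t|lborel. F m t) < (LINT t|lborel. F n t)"
    using int[of m] int[of n] mn le less interior_subset[of \<Omega>]
    by (intro lborel_integral_strict_mono) auto
  then show ?thesis
    using assms(4) by (simp add: R)
qed

section \<open>Uniqueness of the density\<close>

theorem theorem4p17:
  fixes a b \<psi> c0 u_m :: real
    and w :: "real ^ 2 \<Rightarrow> real"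
    and \<Omega> :: "(real ^ 2) set"
  assumes "a > 0" and "b > 0"
    and "0 < 2 * \<psi>" and "2 * \<psi> < pi"
    and "c0 > 0"
    and "smooth_on UNIV w" and "\<And>x. x \<in> ball 0 1 \<Longrightarrow> w x > 0"
    and "compact_domain \<Omega>" and "smooth_boundary \<Omega>" and "\<Omega> \<subseteq> ball 0 1"
    and "u_m > 0"
  shows "\<exists>\<epsilon>0>0. \<forall>\<epsilon>. 0 < \<epsilon> \<and> \<epsilon> < \<epsilon>0 \<longrightarrow>
    (\<forall>n\<in>{0..u_m}. \<forall>n'\<in>{0..u_m}.
       (\<forall>s. \<forall>\<theta>\<in>{-pi..pi}.
          R_transform a b \<psi> (disc_kernel \<epsilon>) c0 w (\<lambda>x. n * indicator \<Omega> x) s \<theta> =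
          R_transform a b \<psi> (disc_kernel \<epsilon>) c0 w (\<lambda>x. n' * indicator \<Omega> x) s \<theta>)
       \<longrightarrow> n = n')"
proof -
  have \<Omega>: "compact \<Omega>" "interior \<Omega> \<noteq> {}" "\<Omega> = closure (interior \<Omega>)"
    using \<open>compact_domain \<Omega>\<close> by (auto simp: compact_domain_def)
  have "continuous_on UNIV w"
    using \<open>smooth_on UNIV w\<close> unfolding smooth_on_def by (metis Ck_on.simps(1))
  have "\<Omega> \<noteq> {}"
    using \<Omega>(2) interior_subset by fastforce
  then obtain p where p: "p \<in> \<Omega>" "\<And>x. x \<in> \<Omega> \<Longrightarrow> norm x \<le> norm p"
    using continuous_attains_sup[of \<Omega> norm] \<Omega>(1) continuous_on_norm_id by metis
  define R where "R = norm p"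
  obtain \<theta> where \<theta>: "\<theta> \<in> {-pi..pi}" "p = R *\<^sub>R dir \<theta>"
    unfolding R_def using polar_dir_exists by blast
  have "R > 0"
  proof (rule ccontr)
    assume "\<not> R > 0"
    then have "interior \<Omega> \<subseteq> interior {0}"
      using p(2) by (intro interior_mono) (auto simp: R_def)
    with \<Omega>(2) show False
      by simp
  qed
  \<comment> \<open>Chosen so that \<open>u_m\<close> times the bound of
    \<open>smoothed_V_line_indicator_le\<close> is \<open>1 / 2\<close>.\<close>
  define D where "D = 1 / (4 * pi * (a + b) * u_m)"
  have D: "u_m * (pi * ((a + b) * (2 * D))) = 1 / 2" "D > 0"
  proof -
    have "a + b > 0"
      using assms by simp
    then show "u_m * (pi * ((a + b) * (2 * D))) = 1 / 2" "D > 0"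
      using \<open>u_m > 0\<close> by (simp_all add: D_def)
  qed
  \<comment> \<open>Solves the diameter condition of \<open>cap_dist_le\<close> for
    \<open>r\<close>; the maximum covers the case \<open>D > 2 * R\<close>.\<close>
  define r where "r = sqrt (max 0 (R\<^sup>2 - D\<^sup>2 / 4))"
  have "0 \<le> r" and r: "4 * R\<^sup>2 - 4 * r\<^sup>2 \<le> D\<^sup>2"
    by (auto simp: r_def max_def)
  have "r < R"
    unfolding r_def using \<open>R > 0\<close> D(2) by (intro real_less_lsqrt) auto
  \<comment> \<open>The open half plane is a neighbourhood of \<open>p\<close>, which is a limit of
    interior points of \<open>\<Omega>\<close>.\<close>
  have "p \<in> {x. r < x \<bullet> dir \<theta>}"
    using \<open>r < R\<close> by (simp add: \<theta>(2) inner_dir_dir)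
  moreover have "open {x. r < x \<bullet> dir \<theta>}"
    by (intro open_Collect_less continuous_intros)
  moreover have "p \<in> closure (interior \<Omega>)"
    using p(1) \<Omega>(3) by simp
  ultimately obtain q where q: "q \<in> interior \<Omega>" "r < q \<bullet> dir \<theta>"
    by (auto simp: closure_iff_nhds_not_empty)
  define s where "s = q \<bullet> dir \<theta>"
  have diam: "dist u v \<le> D" if "u \<in> \<Omega>" "v \<in> \<Omega>" "r \<le> u \<bullet> dir \<theta>" "r \<le> v \<bullet> dir \<theta>" for u v
    using that p(2) \<open>0 \<le> r\<close> r D(2) by (intro cap_dist_le[of "dir \<theta>" r u R v D]) (auto simp: R_def)
  have strict: "R_transform a b \<psi> (disc_kernel \<epsilon>) c0 w (\<lambda>x. m * indicator \<Omega> x) s \<theta> <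
      R_transform a b \<psi> (disc_kernel \<epsilon>) c0 w (\<lambda>x. n * indicator \<Omega> x) s \<theta>"
    if "0 < \<epsilon>" "\<epsilon> < s - r" "0 \<le> m" "m < n" "n \<le> u_m" for \<epsilon> m n
  proof (rule R_transform_strict_mono)
    fix x assume "x \<in> line s \<theta>"
    then have "smoothed_V_line (disc_kernel \<epsilon>) a b \<psi> (indicator \<Omega>) x \<theta> \<le> pi * ((a + b) * (2 * D))"
      using assms \<Omega>(1) that D(2) diam
      by (intro smoothed_V_line_indicator_le[where r = r]) (auto simp: line_def compact_imp_closed)
    then have "n * smoothed_V_line (disc_kernel \<epsilon>) a b \<psi> (indicator \<Omega>) x \<theta> \<le>
        u_m * (pi * ((a + b) * (2 * D)))"
      using that assms D(2) by (intro order_trans[OF mult_left_mono mult_right_mono]) auto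
    also have "\<dots> = 1 / 2"
      by (rule D(1))
    finally show "n * smoothed_V_line (disc_kernel \<epsilon>) a b \<psi> (indicator \<Omega>) x \<theta> < 1"
      by simp
  next
    show "w x > 0" if "x \<in> \<Omega>" for x
      using assms(7)[of x] that assms(10) by blast
  next
    show "q \<in> line s \<theta>"
      by (simp add: line_def s_def)
  qed (use assms \<Omega>(1) \<open>continuous_on UNIV w\<close> q(1) that in \<open>auto simp: disc_kernel_def\<close>)
  show ?thesis
  \<comment> \<open>The gap between the chosen line and the edge of the cap is the room available
    for smoothing.\<close>
  proof (intro exI[of _ "s - r"] conjI allI impI ballI)
    show "s - r > 0"
      using q(2) by (simp add: s_def)
  next
    fix \<epsilon> n n'
    assume \<epsilon>: "0 < \<epsilon> \<and> \<epsilon> < s - r" and n: "n \<in> {0..u_m}" "n' \<in> {0..u_m}"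
      and "\<forall>s. \<forall>\<theta>\<in>{-pi..pi}.
          R_transform a b \<psi> (disc_kernel \<epsilon>) c0 w (\<lambda>x. n * indicator \<Omega> x) s \<theta> =
          R_transform a b \<psi> (disc_kernel \<epsilon>) c0 w (\<lambda>x. n' * indicator \<Omega> x) s \<theta>"
    then show "n = n'"
      \<comment> \<open>The single line with parameters \<open>s\<close> and \<open>\<theta>\<close>
        already separates two distinct densities.\<close>
      using strict[of \<epsilon> n n'] strict[of \<epsilon> n' n] \<theta>(1)
      by (cases n n' rule: linorder_cases) auto
  qed
qed

end
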